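(* Let $L$ be a preregular locale. Then $L$ is a Scott locale.
   Context: A locale is a complete lattice $L$ in which finite meets distribute over arbitrary joins (a frame), with top $1$ and bottom $0$; for $a \in L$, the pseudo-complement is $\neg a = \bigvee\{b \in L \mid a \wedge b = 0\}$. For $a,x \in L$, $a$ is well inside $x$ if $\neg a \vee x = 1$. An element $x \in L$ is prime if $x \neq 1$ and, for all $a,b\in L$, $a \wedge b \leq x$ implies $a \leq x$ or $b \leq x$. The spectrum $\Sigma(L)$ is the set of prime elements of $L$, with the topology whose open sets are exactly the sets $\mathcal{U}_a = \{x \in \Sigma(L) \mid a \nleq x\}$ for $a \in L$. The locale $L$ is called preregular if every prime element $x \in \Sigma(L)$ satisfies $x = \bigvee\{a \in L \mid a \text{ is well inside } x\}$ (the condition is required only for prime elements). The Scott topology on $L$ has as open sets the upward closed subsets $\mathcal{U} \subseteq L$ such that for every directed (nonempty) subset $D \subseteq L$ with $\bigvee D \in \mathcal{U}$ one has $D \cap \mathcal{U} \neq \emptyset$. The locale $L$ is called a Scott locale if the inclusion map $p: \Sigma(L) \to L$ is continuous when $\Sigma(L)$ carries the topology above and $L$ carries the Scott topology. *)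

theory Defs
  imports "HOL-Analysis.Abstract_Topology"
begin

(* A locale is a type of class frame; the finite meets are generated by the binary meet and top. *)
class frame = complete_lattice +
  assumes inf_Sup_distrib: "inf a (Sup B) = (SUP b\<in>B. inf a b)"

definition pseudocomplement :: "'a::frame \<Rightarrow> 'a" where
  "pseudocomplement a = Sup {b. inf a b = bot}"

definition well_inside :: "'a::frame \<Rightarrow> 'a \<Rightarrow> bool" where
  "well_inside a x \<longleftrightarrow> sup (pseudocomplement a) x = top"

definition prime_elt :: "'a::frame \<Rightarrow> bool" where
  "prime_elt x \<longleftrightarrow> x \<noteq> top \<and> (\<forall>a b. inf a b \<le> x \<longrightarrow> a \<le> x \<or> b \<le> x)"

definition spectrum :: "'a::frame set" where
  "spectrum = {x. prime_elt x}"

definition spectrum_open :: "'a::frame \<Rightarrow> 'a set" where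
  "spectrum_open a = {x \<in> spectrum. \<not> a \<le> x}"

definition spectrum_topology :: "'a::frame topology" where
  "spectrum_topology = topology (\<lambda>S. \<exists>a. S = spectrum_open a)"

definition directed :: "'a::order set \<Rightarrow> bool" where
  "directed D \<longleftrightarrow> D \<noteq> {} \<and> (\<forall>x\<in>D. \<forall>y\<in>D. \<exists>z\<in>D. x \<le> z \<and> y \<le> z)"

definition scott_open :: "'a::complete_lattice set \<Rightarrow> bool" where
  "scott_open U \<longleftrightarrow>
     (\<forall>x\<in>U. \<forall>y. x \<le> y \<longrightarrow> y \<in> U) \<and>
     (\<forall>D. directed D \<longrightarrow> Sup D \<in> U \<longrightarrow> D \<inter> U \<noteq> {})"

definition scott_topology :: "'a::complete_lattice topology" where
  "scott_topology = topology scott_open"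

definition preregular :: "'a::frame itself \<Rightarrow> bool" where
  "preregular _ \<longleftrightarrow> (\<forall>x\<in>(spectrum :: 'a set). x = Sup {a. well_inside a x})"

definition scott_locale :: "'a::frame itself \<Rightarrow> bool" where
  "scott_locale _ \<longleftrightarrow>
     continuous_map (spectrum_topology :: 'a topology) (scott_topology :: 'a topology) (\<lambda>x. x)"

(* topology is an abstract constructor that is only meaningful on families satisfying istopology,
   so the open sets of the two topologies are computed here. *)

lemma istopology_spectrum: "istopology (\<lambda>S. \<exists>a::'a::frame. S = spectrum_open a)"
  unfolding istopology_def
proof (intro conjI allI impI)
  fix S T :: "'a set"
  assume "\<exists>a. S = spectrum_open a" "\<exists>a. T = spectrum_open a"
  then obtain a b where "S = spectrum_open a" "T = spectrum_open b" by blast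
  then have "S \<inter> T = spectrum_open (inf a b)"
    by (auto simp: spectrum_open_def spectrum_def prime_elt_def
             intro: le_infI1 le_infI2)
  then show "\<exists>a. S \<inter> T = spectrum_open a" by blast
next
  fix K :: "'a set set"
  assume "\<forall>S\<in>K. \<exists>a. S = spectrum_open a"
  then obtain f where f: "\<And>S. S \<in> K \<Longrightarrow> S = spectrum_open (f S)" by metis
  have "x \<in> \<Union>K \<longleftrightarrow> x \<in> spectrum_open (SUP S\<in>K. f S)" for x
  proof -
    have "x \<in> \<Union>K \<longleftrightarrow> (\<exists>S\<in>K. x \<in> spectrum_open (f S))"
      using f by blast
    also have "\<dots> \<longleftrightarrow> x \<in> spectrum_open (SUP S\<in>K. f S)"
      by (auto simp: spectrum_open_def SUP_le_iff)
    finally show ?thesis .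
  qed
  then show "\<exists>a. \<Union>K = spectrum_open a" by blast
qed

lemma openin_spectrum_topology:
  "openin spectrum_topology S \<longleftrightarrow> (\<exists>a. S = spectrum_open a)"
  by (simp add: spectrum_topology_def topology_inverse'[OF istopology_spectrum])

lemma topspace_spectrum_topology: "topspace spectrum_topology = (spectrum :: 'a::frame set)"
proof -
  have "spectrum_open top = (spectrum :: 'a set)"
    by (auto simp: spectrum_open_def spectrum_def prime_elt_def top_unique)
  then have "openin spectrum_topology (spectrum :: 'a set)"
    by (metis openin_spectrum_topology)
  moreover have "S \<subseteq> spectrum" if "openin spectrum_topology S" for S :: "'a set"
    using that by (auto simp: openin_spectrum_topology spectrum_open_def)
  ultimately show ?thesis
    by (metis openin_subset openin_topspace subset_antisym)
qed

lemma istopology_scott: "istopology (scott_open :: 'a::complete_lattice set \<Rightarrow> bool)"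
  unfolding istopology_def
proof (intro conjI allI impI)
  fix S T :: "'a set"
  assume S: "scott_open S" and T: "scott_open T"
  show "scott_open (S \<inter> T)"
    unfolding scott_open_def
  proof (intro conjI allI impI ballI)
    fix x y assume "x \<in> S \<inter> T" "x \<le> y"
    then show "y \<in> S \<inter> T" using S T by (auto simp: scott_open_def)
  next
    fix D :: "'a set"
    assume D: "directed D" and sup: "Sup D \<in> S \<inter> T"
    have "D \<inter> S \<noteq> {}" "D \<inter> T \<noteq> {}"
      using S T D sup by (simp_all add: scott_open_def)
    then obtain d e where de: "d \<in> D" "d \<in> S" "e \<in> D" "e \<in> T"
      by blast
    with D obtain z where z: "z \<in> D" "d \<le> z" "e \<le> z"
      unfolding directed_def by metis
    have "z \<in> S"
      using S de(2) z(2) unfolding scott_open_def by metis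
    moreover have "z \<in> T"
      using T de(4) z(3) unfolding scott_open_def by metis
    ultimately have "z \<in> D \<inter> (S \<inter> T)" using z(1) by blast
    then show "D \<inter> (S \<inter> T) \<noteq> {}" by blast
  qed
next
  fix K :: "'a set set"
  assume K: "\<forall>S\<in>K. scott_open S"
  show "scott_open (\<Union>K)"
    unfolding scott_open_def
  proof (intro conjI allI impI ballI)
    fix x y assume "x \<in> \<Union>K" and le: "x \<le> y"
    then obtain S where S: "S \<in> K" "x \<in> S" by blast
    with K le have "y \<in> S" unfolding scott_open_def by metis
    with S show "y \<in> \<Union>K" by blast
  next
    fix D :: "'a set"
    assume D: "directed D" and "Sup D \<in> \<Union>K"
    then obtain S where S: "S \<in> K" "Sup D \<in> S" by blast
    with K D have "D \<inter> S \<noteq> {}" unfolding scott_open_def by metis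
    with S show "D \<inter> \<Union>K \<noteq> {}" by blast
  qed
qed

lemma openin_scott_topology: "openin scott_topology U \<longleftrightarrow> scott_open U"
  by (simp add: scott_topology_def topology_inverse'[OF istopology_scott])

lemma topspace_scott_topology: "topspace scott_topology = UNIV"
proof -
  have "scott_open UNIV" by (auto simp: scott_open_def directed_def)
  then show ?thesis by (auto simp: topspace_def openin_scott_topology)
qed

end

theory Submission
  imports Defs
begin

text \<open>
  If a prime \<open>x\<close> lies in a Scott open set \<open>U\<close>, then \<open>x\<close> is the directed join of the elements well
  inside it, so some such \<open>a\<close> already lies in \<open>U\<close>. As \<open>x \<noteq> 1\<close>, the pseudo-complement \<open>\<not>a\<close> is not below
  \<open>x\<close>. Conversely, \<open>a \<and> \<not>a = 0\<close> forces \<open>a \<le> y\<close>, hence \<open>y \<in> U\<close>, for every prime \<open>y\<close> with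
  \<open>\<not>a \<nleq> y\<close>. So the trace of \<open>U\<close> on the spectrum is the open set given by the join of all \<open>\<not>a\<close> with
  \<open>a \<in> U\<close>.
\<close>

lemma frame_inf_sup_distrib:
  fixes a b c :: "'a::frame"
  shows "inf a (sup b c) = sup (inf a b) (inf a c)"
  using inf_Sup_distrib[of a "{b, c}"] by simp

text \<open>By distributivity, the join of all elements disjoint from \<open>a\<close> is itself
  disjoint from \<open>a\<close>, hence the largest of them.\<close>

lemma inf_pseudocomplement: "inf a (pseudocomplement a) = (bot :: 'a::frame)"
  unfolding pseudocomplement_def inf_Sup_distrib by (simp cong: SUP_cong_simp)

lemma le_pseudocomplement_iff:
  fixes a b :: "'a::frame"
  shows "b \<le> pseudocomplement a \<longleftrightarrow> inf a b = bot"
proof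
  assume "b \<le> pseudocomplement a"
  then have "inf a b \<le> inf a (pseudocomplement a)" by (rule inf_mono[OF order_refl])
  then show "inf a b = bot" by (simp add: inf_pseudocomplement bot_unique)
next
  assume "inf a b = bot"
  then show "b \<le> pseudocomplement a" by (simp add: pseudocomplement_def Sup_upper)
qed

lemma pseudocomplement_sup_ge:
  fixes a b :: "'a::frame"
  shows "inf (pseudocomplement a) (pseudocomplement b) \<le> pseudocomplement (sup a b)"
proof -
  let ?p = "inf (pseudocomplement a) (pseudocomplement b)"
  have "inf a ?p = bot" "inf b ?p = bot"
    by (simp_all flip: le_pseudocomplement_iff)
  then have "inf (sup a b) ?p = bot"
    using frame_inf_sup_distrib[of ?p a b] by (simp add: inf_commute)
  then show ?thesis by (simp add: le_pseudocomplement_iff)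
qed

lemma well_inside_bot: "well_inside bot (x :: 'a::frame)"
proof -
  have "pseudocomplement (bot :: 'a) = top"
    by (simp add: pseudocomplement_def)
  then show ?thesis by (simp add: well_inside_def)
qed

lemma well_inside_sup:
  fixes a b x :: "'a::frame"
  assumes a: "well_inside a x" and b: "well_inside b x"
  shows "well_inside (sup a b) x"
proof -
  let ?a = "pseudocomplement a" and ?b = "pseudocomplement b"
  \<comment> \<open>Meeting with \<open>sup ?b x\<close>, which is top, changes nothing;
    distributing then leaves \<open>inf ?a ?b\<close> and a part below \<open>x\<close>.\<close>
  have "?a = inf ?a (sup ?b x)" using b by (simp add: well_inside_def)
  also have "\<dots> \<le> sup (inf ?a ?b) x"
    unfolding frame_inf_sup_distrib by (rule sup_mono) auto
  also have "\<dots> \<le> sup (pseudocomplement (sup a b)) x"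
    by (rule sup_mono[OF pseudocomplement_sup_ge order_refl])
  finally have "sup ?a x \<le> sup (pseudocomplement (sup a b)) x" by (rule sup_least) simp
  then show ?thesis using a unfolding well_inside_def by (metis top_unique)
qed

text \<open>Nonempty because of \<open>bot\<close>; binary joins supply the upper bounds.\<close>

lemma directed_well_inside: "directed {a. well_inside a (x :: 'a::frame)}"
  unfolding directed_def by (metis (mono_tags) empty_iff mem_Collect_eq sup_ge1 sup_ge2 well_inside_bot well_inside_sup)

lemma prime_elt_cases:
  fixes y :: "'a::frame"
  assumes "prime_elt y"
  shows "a \<le> y \<or> pseudocomplement a \<le> y"
proof -
  have "inf a (pseudocomplement a) \<le> y" by (simp add: inf_pseudocomplement)
  with assms show ?thesis unfolding prime_elt_def by blast
qed

lemma scott_open_Int_spectrum: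
  fixes U :: "'a::frame set"
  assumes pre: "preregular TYPE('a)" and U: "scott_open U"
  shows "spectrum \<inter> U = spectrum_open (SUP a\<in>U. pseudocomplement a)"
proof -
  have "x \<in> U \<longleftrightarrow> (\<exists>a\<in>U. \<not> pseudocomplement a \<le> x)" if x: "prime_elt x" for x
  proof
    assume "x \<in> U"
    moreover have "x = Sup {a. well_inside a x}"
      using pre x by (simp add: preregular_def spectrum_def)
    ultimately have "Sup {a. well_inside a x} \<in> U" by simp
    then obtain a where "a \<in> U" "well_inside a x"
      using U directed_well_inside[of x] unfolding scott_open_def by blast
    \<comment> \<open>Otherwise the join of \<open>pseudocomplement a\<close> and \<open>x\<close>,
      which is top, would equal \<open>x\<close>.\<close>
    moreover from this have "\<not> pseudocomplement a \<le> x"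
      using x by (auto simp: well_inside_def prime_elt_def sup_absorb2)
    ultimately show "\<exists>a\<in>U. \<not> pseudocomplement a \<le> x" by blast
  next
    assume "\<exists>a\<in>U. \<not> pseudocomplement a \<le> x"
    then obtain a where "a \<in> U" "a \<le> x" using prime_elt_cases[OF x] by blast
    then show "x \<in> U" using U unfolding scott_open_def by blast
  qed
  \<comment> \<open>A join fails to lie below \<open>x\<close> exactly when one of its members
    does.\<close>
  then show ?thesis by (auto simp: spectrum_open_def spectrum_def SUP_le_iff)
qed

theorem theorem4p2:
  assumes "preregular TYPE('a::frame)"
  shows "scott_locale TYPE('a)"
proof -
  have "{x \<in> spectrum. x \<in> U} = spectrum_open (SUP a\<in>U. pseudocomplement a)"
    if "scott_open U" for U :: "'a set"
    using scott_open_Int_spectrum[OF assms that] by (simp add: Int_def)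
  then show ?thesis
    unfolding scott_locale_def continuous_map_def topspace_spectrum_topology
      topspace_scott_topology openin_scott_topology openin_spectrum_topology
    by blast
qed

end
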